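(* Let $A\subset\mathbb{R}^n$ be finite, $\Omega=\operatorname{conv}(A)$ with at least two points and diameter $D$, and $f\in C^1(\Omega)$ with $L$-Lipschitz gradient on $\Omega$ ($L>0$). Let $\{x_k\}$ be generated by the first-order method with SSC, where the method used in the SSC is the AFW (respectively the PFW, the FDFW). Set $\tau=\frac{\mathrm{PWidth}(A)}{2D}$ for the AFW (respectively $\tau=\frac{\mathrm{PWidth}(A)}{D}$ for the PFW, $\tau=\frac{\mathrm{PFWidth}(\Omega)}{2D}$ for the FDFW), $K=\frac{\tau}{L(1+\tau)}$, and $\tilde f=\lim_kf(x_k)$. Let $\{\tilde x_k\}$ be any sequence such that for every $k$: $\tilde x_k$ is one of the points $y_0,\dots,y_T$ generated by the SSC call producing $x_{k+1}$ from $x_k$, $f(x_{k+1})\le f(\tilde x_k)\le f(x_k)-\frac L2\|x_k-\tilde x_k\|^2$, $\|\tilde x_k-x_k\|\le\|x_{k+1}-x_k\|$, and $\|x_k-x_{k+1}\|\ge K\|\pi(T_\Omega(\tilde x_k),-\nabla f(\tilde x_k))\|$. Then for every $k$ $$\min_{0\le i\le k}\|\pi(T_\Omega(\tilde x_i),-\nabla f(\tilde x_i))\|\le\min_{0\le i\le k}\frac{\|x_{i+1}-x_i\|}{K}\le\sqrt{\frac{2(f(x_0)-\tilde f)}{K^2L(k+1)}}.$$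
   Context: $\|\cdot\|$ is the Euclidean norm, $\hat c=c/\|c\|$ for $c\ne0$ and $\hat0=0$, $\bar B_R(x)$ the closed ball. $f\in C^1(\Omega)$ means continuously differentiable on an open set containing $\Omega$; $\|\nabla f(x)-\nabla f(y)\|\le L\|x-y\|$ for $x,y\in\Omega$. $T_\Omega(x)=\mathrm{cl}\{w:\exists\lambda>0,\ x+\lambda w\in\Omega\}$, $\pi(C,\cdot)$ is the Euclidean projection on a closed convex set $C$, $\pi_x(g)=\|\pi(T_\Omega(x),g)\|$; $x$ is stationary if $\pi_x(-\nabla f(x))=0$. First-order method with SSC: from $x_0\in\Omega$, while $x_k$ is not stationary set $x_{k+1}=\mathrm{SSC}(x_k,-\nabla f(x_k))$. If some $x_m$ is stationary, the convention is $x_k=\tilde x_k=x_m$ for all $k\ge m$. Procedure $\mathrm{SSC}(\bar x,g)$ (with $g=-\nabla f(\bar x)$): set $y_0=\bar x$, $j=0$. (1) Select a direction $d_j$ at $y_j$ for $g$ by the chosen method, with its maximal stepsize $\alpha^{(j)}_{\max}$ (below); $d_j=0$ if and only if $\pi_{y_j}(g)=0$. If $d_j=0$, return $y_j$. (2) Let $\Omega_j=\bar B_{\|g\|/(2L)}\!\left(\bar x+\frac{g}{2L}\right)\cap\bar B_{\langle g,\hat d_j\rangle/L}(\bar x)$, and let $\beta_j=0$ if $y_j\notin\Omega_j$, $\beta_j=\max\{\beta\ge0:y_j+\beta d_j\in\Omega_j\}$ if $y_j\in\Omega_j$. Set $\alpha_j=\min(\alpha^{(j)}_{\max},\beta_j)$,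 $y_{j+1}=y_j+\alpha_jd_j$. If $\alpha_j=\beta_j$, return $y_{j+1}$; otherwise set $j=j+1$ and go to (1). The index $T$ is such that the returned point is $y_T$. Methods (direction $d$ at $y$ for $g$ with $\pi_y(g)\ne0$, stepsize $\alpha$). AFW and PFW keep (also across SSC calls) an active representation $y=\sum_{a\in S}\lambda_aa$, $S\subset A$, $\lambda_a>0$, $\sum_{a\in S}\lambda_a=1$. Let $s\in A$ maximize $\langle s,g\rangle$ over $\Omega$ and $q\in\arg\min_{q\in S}\langle q,g\rangle$. PFW: $d=s-q$, $\alpha_{\max}=\lambda_q$; weight $\alpha$ is moved from $q$ to $s$. AFW: $d\in\arg\max\{\langle g,d\rangle:d\in\{s-y,\,y-q\}\}$; for $d=s-y$, $\alpha_{\max}=1$, weights are multiplied by $1-\alpha$ and $\alpha$ is added to the weight of $s$; for $d=y-q$, $\alpha_{\max}=\lambda_q/(1-\lambda_q)$, weights are multiplied by $1+\alpha$ and $\alpha$ is subtracted from the weight of $q$. Atoms with zero weight are removed from $S$. FDFW: $d\in\arg\max\{\langle g,d\rangle:d\in\{s-y,\,y-y_F\}\}$ with $s\in\arg\max_{s\in\Omega}\langle s,g\rangle$, $y_F\in\arg\min\{\langle g,z\rangle:z\in\mathcal F(y)\}$, $\mathcal F(y)$ the minimal face of $\Omega$ containing $y$; $\alpha_{\max}=\max\{\alpha\ge0:y+\alpha d\in\Omega\}$. With $\mathrm{pfaces}(\Omega)$ the set of nonempty proper faces of $\Omega$ and $\operatorname{dist}(C,E)=\inf\{\|y-z\|:y\in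 C,z\in E\}$: $\mathrm{PWidth}(A)=\min_{\mathcal F\in\mathrm{pfaces}(\Omega)}\operatorname{dist}(\mathcal F,\operatorname{conv}(A\setminus\mathcal F))$ and $\mathrm{PFWidth}(\Omega)=\min\{\operatorname{dist}(\mathcal F_1,\mathcal F_2):\mathcal F_1,\mathcal F_2\in\mathrm{pfaces}(\Omega),\ \mathcal F_1\cap\mathcal F_2=\emptyset\}$. *)

theory Defs
  imports "HOL-Analysis.Analysis"
begin

section \<open>Tangent cone and stationarity\<close>

definition tangent_cone :: "'a::euclidean_space set \<Rightarrow> 'a \<Rightarrow> 'a set" where
  "tangent_cone \<Omega> x = closure {w. \<exists>t>0. x + t *\<^sub>R w \<in> \<Omega>}"

definition proj_tangent :: "'a::euclidean_space set \<Rightarrow> 'a \<Rightarrow> 'a \<Rightarrow> real" where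
  "proj_tangent \<Omega> x g = norm (closest_point (tangent_cone \<Omega> x) g)"


section \<open>Pyramidal and facial widths\<close>

text \<open>The library counts the empty set as a face; \<open>pfaces\<close> excludes it.\<close>

definition pfaces :: "'a::euclidean_space set \<Rightarrow> 'a set set" where
  "pfaces \<Omega> = {F. F face_of \<Omega> \<and> F \<noteq> {} \<and> F \<noteq> \<Omega>}"

definition PWidth :: "'a::euclidean_space set \<Rightarrow> real" where
  "PWidth A = (MIN F\<in>pfaces (convex hull A). setdist F (convex hull (A - F)))"

definition PFWidth :: "'a::euclidean_space set \<Rightarrow> real" where
  "PFWidth \<Omega> =
     Min {setdist F G | F G. F \<in> pfaces \<Omega> \<and> G \<in> pfaces \<Omega> \<and> F \<inter> G = {}}"

definition min_face :: "'a::euclidean_space set \<Rightarrow> 'a \<Rightarrow> 'a set" where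
  "min_face \<Omega> y = \<Inter>{F. F face_of \<Omega> \<and> y \<in> F}"


section \<open>Frank-Wolfe directions\<close>

text \<open>
  An active representation is encoded by its weight function, extended by zero; the active
  set \<open>S\<close> is the support of the weights, so that atoms whose weight becomes zero leave \<open>S\<close>
  without further action.
\<close>

definition active_set :: "('a \<Rightarrow> real) \<Rightarrow> 'a set" where
  "active_set w = {a. w a \<noteq> 0}"

definition active_rep :: "'a::euclidean_space set \<Rightarrow> 'a \<Rightarrow> ('a \<Rightarrow> real) \<Rightarrow> bool" where
  "active_rep A y w \<longleftrightarrow>
     active_set w \<subseteq> A \<and> (\<forall>a\<in>active_set w. w a > 0) \<and>
     (\<Sum>a\<in>active_set w. w a) = 1 \<and> y = (\<Sum>a\<in>active_set w. w a *\<^sub>R a)"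

datatype fw_method = AFW | PFW | FDFW

text \<open>
  \<open>fw_direction A g M y w d \<alpha>max upd\<close>: at the point \<open>y\<close> with weights \<open>w\<close>, method \<open>M\<close> may select
  the direction \<open>d\<close> for \<open>g\<close>, with maximal stepsize \<open>\<alpha>max\<close>; \<open>upd \<alpha>\<close> are the weights after the
  stepsize \<open>\<alpha>\<close>. It is a relation because ties in the argmax/argmin are broken arbitrarily.
  FDFW uses no weights and merely passes them through.
\<close>

inductive fw_direction ::
  "'a::euclidean_space set \<Rightarrow> 'a \<Rightarrow> fw_method \<Rightarrow> 'a \<Rightarrow> ('a \<Rightarrow> real) \<Rightarrow> 'a \<Rightarrow> real
     \<Rightarrow> (real \<Rightarrow> 'a \<Rightarrow> real) \<Rightarrow> bool"
  for A :: "'a set" and g :: 'a where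
  AFW_forward:
    "\<lbrakk>s \<in> A; is_arg_max (\<lambda>z. z \<bullet> g) (\<lambda>z. z \<in> convex hull A) s;
      is_arg_min (\<lambda>z. z \<bullet> g) (\<lambda>z. z \<in> active_set w) q;
      is_arg_max (\<lambda>d. g \<bullet> d) (\<lambda>d. d \<in> {s - y, y - q}) (s - y)\<rbrakk>
     \<Longrightarrow> fw_direction A g AFW y w (s - y) 1
           (\<lambda>\<alpha> a. (1 - \<alpha>) * w a + (if a = s then \<alpha> else 0))"
| AFW_away:
    "\<lbrakk>s \<in> A; is_arg_max (\<lambda>z. z \<bullet> g) (\<lambda>z. z \<in> convex hull A) s;
      is_arg_min (\<lambda>z. z \<bullet> g) (\<lambda>z. z \<in> active_set w) q;
      is_arg_max (\<lambda>d. g \<bullet> d) (\<lambda>d. d \<in> {s - y, y - q}) (y - q)\<rbrakk>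
     \<Longrightarrow> fw_direction A g AFW y w (y - q) (w q / (1 - w q))
           (\<lambda>\<alpha> a. (1 + \<alpha>) * w a - (if a = q then \<alpha> else 0))"
| PFW_pairwise:
    "\<lbrakk>s \<in> A; is_arg_max (\<lambda>z. z \<bullet> g) (\<lambda>z. z \<in> convex hull A) s;
      is_arg_min (\<lambda>z. z \<bullet> g) (\<lambda>z. z \<in> active_set w) q\<rbrakk>
     \<Longrightarrow> fw_direction A g PFW y w (s - q) (w q)
           (\<lambda>\<alpha> a. w a + (if a = s then \<alpha> else 0) - (if a = q then \<alpha> else 0))"
| FDFW_step:
    "\<lbrakk>is_arg_max (\<lambda>z. z \<bullet> g) (\<lambda>z. z \<in> convex hull A) s;
      is_arg_min (\<lambda>z. g \<bullet> z) (\<lambda>z. z \<in> min_face (convex hull A) y) yF;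
      is_arg_max (\<lambda>d. g \<bullet> d) (\<lambda>d. d \<in> {s - y, y - yF}) d\<rbrakk>
     \<Longrightarrow> fw_direction A g FDFW y w d
           (GREATEST \<alpha>. 0 \<le> \<alpha> \<and> y + \<alpha> *\<^sub>R d \<in> convex hull A) (\<lambda>\<alpha>. w)"

fun fw_tau :: "fw_method \<Rightarrow> 'a::euclidean_space set \<Rightarrow> real" where
  "fw_tau AFW A = PWidth A / (2 * diameter (convex hull A))"
| "fw_tau PFW A = PWidth A / diameter (convex hull A)"
| "fw_tau FDFW A = PFWidth (convex hull A) / (2 * diameter (convex hull A))"


section \<open>Short step chain\<close>

text \<open>The unit vector of \<open>c\<close> (zero for \<open>c = 0\<close>) is \<open>sgn c\<close>.\<close>

definition ssc_region :: "real \<Rightarrow> 'a::euclidean_space \<Rightarrow> 'a \<Rightarrow> 'a \<Rightarrow> 'a set" where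
  "ssc_region L xb g d =
     cball (xb + (1 / (2 * L)) *\<^sub>R g) (norm g / (2 * L)) \<inter> cball xb ((g \<bullet> sgn d) / L)"

definition ssc_beta :: "real \<Rightarrow> 'a::euclidean_space \<Rightarrow> 'a \<Rightarrow> 'a \<Rightarrow> 'a \<Rightarrow> real" where
  "ssc_beta L xb g y d =
     (if y \<in> ssc_region L xb g d
      then (GREATEST \<beta>. 0 \<le> \<beta> \<and> y + \<beta> *\<^sub>R d \<in> ssc_region L xb g d)
      else 0)"

text \<open>
  \<open>ssc_trace M A L xb g (y, w) ys\<close>: the procedure \<open>SSC(xb, g)\<close>, continued from the point \<open>y\<close> with
  weights \<open>w\<close>, can terminate, and \<open>ys\<close> is the list of the pairs (point, weights) it passes
  through, from \<open>(y, w)\<close> to the returned one. A whole call is a trace from \<open>y = xb\<close>; it lists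
  \<open>y\<^sub>0, \<dots>, y\<^sub>T\<close>, and \<open>T\<close> is its length minus one.
\<close>

inductive ssc_trace ::
  "fw_method \<Rightarrow> 'a::euclidean_space set \<Rightarrow> real \<Rightarrow> 'a \<Rightarrow> 'a \<Rightarrow> 'a \<times> ('a \<Rightarrow> real)
     \<Rightarrow> ('a \<times> ('a \<Rightarrow> real)) list \<Rightarrow> bool"
  for M :: fw_method and A :: "'a set" and L :: real and xb :: 'a and g :: 'a where
  stationary:
    "proj_tangent (convex hull A) y g = 0 \<Longrightarrow> ssc_trace M A L xb g (y, w) [(y, w)]"
| return:
    "\<lbrakk>proj_tangent (convex hull A) y g \<noteq> 0; fw_direction A g M y w d \<alpha>max upd;
      \<alpha> = min \<alpha>max (ssc_beta L xb g y d); \<alpha> = ssc_beta L xb g y d\<rbrakk>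
     \<Longrightarrow> ssc_trace M A L xb g (y, w) [(y, w), (y + \<alpha> *\<^sub>R d, upd \<alpha>)]"
| continue:
    "\<lbrakk>proj_tangent (convex hull A) y g \<noteq> 0; fw_direction A g M y w d \<alpha>max upd;
      \<alpha> = min \<alpha>max (ssc_beta L xb g y d); \<alpha> \<noteq> ssc_beta L xb g y d;
      ssc_trace M A L xb g (y + \<alpha> *\<^sub>R d, upd \<alpha>) ys\<rbrakk>
     \<Longrightarrow> ssc_trace M A L xb g (y, w) ((y, w) # ys)"

text \<open>
  The run of the first-order method: \<open>x k\<close> are the iterates, \<open>w k\<close> the weights kept across SSC
  calls, and \<open>tr k\<close> the trace of the call producing \<open>x (Suc k)\<close>. From a stationary iterate on,
  the run is constant.
\<close>

definition fom_ssc ::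
  "fw_method \<Rightarrow> 'a::euclidean_space set \<Rightarrow> real \<Rightarrow> ('a \<Rightarrow> 'a) \<Rightarrow> (nat \<Rightarrow> 'a)
     \<Rightarrow> (nat \<Rightarrow> 'a \<Rightarrow> real) \<Rightarrow> (nat \<Rightarrow> ('a \<times> ('a \<Rightarrow> real)) list) \<Rightarrow> bool" where
  "fom_ssc M A L gradf x w tr \<longleftrightarrow>
     x 0 \<in> convex hull A \<and> (M \<in> {AFW, PFW} \<longrightarrow> active_rep A (x 0) (w 0)) \<and>
     (\<forall>k. (if proj_tangent (convex hull A) (x k) (- gradf (x k)) = 0
            then tr k = [(x k, w k)]
            else ssc_trace M A L (x k) (- gradf (x k)) (x k, w k) (tr k)) \<and>
          (x (Suc k), w (Suc k)) = last (tr k))"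

end

theory Submission
  imports Defs
begin

text \<open>
  The hypotheses bound the decrease of \<open>f\<close> by the distance from \<open>x\<^sub>k\<close> to \<open>xt\<^sub>k\<close>, which may be
  smaller than the length of the whole step from \<open>x\<^sub>k\<close> to \<open>x\<^sub>k\<^sub>+\<^sub>1\<close>. The rate needs
  \<open>f(x\<^sub>k\<^sub>+\<^sub>1) \<le> f(x\<^sub>k) - (L/2) \<parallel>x\<^sub>k\<^sub>+\<^sub>1 - x\<^sub>k\<parallel>\<^sup>2\<close>, and this is what the
  short step chain is designed for. Every stepsize is nonnegative and at most \<open>\<beta>\<^sub>j\<close>, so no point of the chain leaves the ball with centre \<open>x\<^sub>k + g/(2L)\<close> and radius \<open>\<parallel>g\<parallel>/(2L)\<close>,
  where \<open>g = -\<nabla>f(x\<^sub>k)\<close>. That ball is the set of the points \<open>y\<close> with \<open>L \<parallel>y - x\<^sub>k\<parallel>\<^sup>2 \<le> g \<bullet> (y - x\<^sub>k)\<close>,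
  on which the quadratic upper model of \<open>f\<close> at \<open>x\<^sub>k\<close> lies below \<open>f(x\<^sub>k) - (L/2) \<parallel>y - x\<^sub>k\<parallel>\<^sup>2\<close>
  (\<open>short_step_ball_iff\<close>, \<open>sufficient_decrease_in_short_step_ball\<close>).

  The quadratic model bounds \<open>f\<close> only on \<open>\<Omega>\<close>, so the chain must also stay feasible: a stepsize
  up to the maximal one keeps the weights of AFW and PFW a convex representation, and keeps the
  FDFW point in \<open>\<Omega>\<close> (\<open>fw_step_keeps_state\<close>). The stepsizes are well-defined maxima because a
  direction selected at a nonstationary point is a strict ascent direction for \<open>g\<close>, hence
  nonzero (\<open>fw_direction_ascent\<close>).

  Finally \<open>K > 0\<close>, because each width is the minimum of finitely many distances between disjoint
  nonempty compact sets (\<open>PWidth_pos\<close>, \<open>PFWidth_pos\<close>). Dividing the hypothesis on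
  the projected gradient by \<open>K\<close> gives the first inequality. The values \<open>f(x\<^sub>k)\<close> decrease and are bounded below on the compact set \<open>\<Omega>\<close>, and
  telescoping the decrease bounds the sum of the squared step lengths, hence \<open>k + 1\<close> times the
  smallest square.
\<close>

section \<open>Positivity of the widths\<close>

lemma convex_hull_complement_face_disjoint:
  assumes "F face_of convex hull A"
  shows "F \<inter> convex hull (A - F) = {}"
proof -
  have "z \<in> convex hull A - F"
    if ab: "a \<in> convex hull A - F" "b \<in> convex hull A - F" and z: "z \<in> open_segment a b" for a b z
  proof -
    have "open_segment a b \<subseteq> convex hull A"
      using ab convex_convex_hull[of A] by (auto simp: convex_contains_open_segment)
    thus ?thesis using face_ofD[OF assms z] ab z by blast
  qed
  hence "convex (convex hull A - F)"
    unfolding convex_contains_open_segment by blast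
  moreover have "A - F \<subseteq> convex hull A - F"
    by (simp add: Diff_mono hull_subset)
  ultimately have "convex hull (A - F) \<subseteq> convex hull A - F"
    by (rule hull_minimal[rotated])
  thus ?thesis by blast
qed

lemma finite_pfaces:
  fixes A :: "'a::euclidean_space set"
  assumes "finite A"
  shows "finite (pfaces (convex hull A))"
proof -
  have "polytope (convex hull A)" using assms by (auto simp: polytope_def)
  hence "finite {F. F face_of convex hull A}" by (rule finite_polytope_faces)
  thus ?thesis by (rule finite_subset[rotated]) (auto simp: pfaces_def)
qed

lemma pfaces_compact:
  fixes A :: "'a::euclidean_space set"
  assumes "finite A" "F \<in> pfaces (convex hull A)"
  shows "compact F"
  using assms face_of_imp_compact[of "convex hull A" F]
  by (auto simp: pfaces_def finite_imp_compact_convex_hull)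

lemma setdist_pos_disjoint_compact:
  fixes S T :: "'a::euclidean_space set"
  assumes "compact S" "compact T" "S \<noteq> {}" "T \<noteq> {}" "S \<inter> T = {}"
  shows "setdist S T > 0"
proof -
  have "setdist S T \<noteq> 0"
    using assms setdist_eq_0_compact_closed[OF assms(1) compact_imp_closed[OF assms(2)]] by blast
  thus ?thesis using setdist_pos_le[of S T] by linarith
qed

text \<open>A compact convex set is the hull of its extreme points, so one extreme point is not enough
  to span two points. Vertices are the disjoint proper faces that make both minima range over a
  nonempty set.\<close>

lemma two_vertices_in_pfaces:
  fixes A :: "'a::euclidean_space set"
  assumes "finite A" "\<exists>a\<in>convex hull A. \<exists>b\<in>convex hull A. a \<noteq> b"
  obtains u v where "u \<noteq> v" "{u} \<in> pfaces (convex hull A)" "{v} \<in> pfaces (convex hull A)"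
proof -
  let ?E = "{x. x extreme_point_of convex hull A}"
  have KM: "convex hull A = convex hull ?E"
    using assms(1) Krein_Milman_Minkowski[of "convex hull A"]
    by (simp add: finite_imp_compact_convex_hull)
  have "\<not> (\<exists>u. ?E \<subseteq> {u})"
  proof
    assume "\<exists>u. ?E \<subseteq> {u}"
    then obtain u where "?E \<subseteq> {u}" by blast
    hence "convex hull A \<subseteq> {u}" using KM hull_mono[of ?E "{u}" convex] by simp
    thus False using assms(2) by blast
  qed
  then obtain u v where "u \<in> ?E" "v \<in> ?E" "u \<noteq> v" by blast
  moreover have "{p} \<in> pfaces (convex hull A)" if "p \<in> ?E" for p
  proof -
    have "{p} face_of convex hull A" using that by (simp add: face_of_singleton)
    moreover have "{p} \<noteq> convex hull A" using assms(2) by (metis singletonD)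
    ultimately show ?thesis by (simp add: pfaces_def)
  qed
  ultimately show ?thesis using that by blast
qed

lemma PWidth_pos:
  fixes A :: "'a::euclidean_space set"
  assumes "finite A" "\<exists>a\<in>convex hull A. \<exists>b\<in>convex hull A. a \<noteq> b"
  shows "PWidth A > 0"
proof -
  have "setdist F (convex hull (A - F)) > 0" if F: "F \<in> pfaces (convex hull A)" for F
  proof (rule setdist_pos_disjoint_compact)
    show "compact F" using pfaces_compact[OF assms(1) F] .
    show "compact (convex hull (A - F))" using assms(1) by (simp add: finite_imp_compact_convex_hull)
    show "F \<noteq> {}" using F by (auto simp: pfaces_def)
    show "F \<inter> convex hull (A - F) = {}"
      using F by (intro convex_hull_complement_face_disjoint) (auto simp: pfaces_def)
    have "\<not> A \<subseteq> F"
    proof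
      assume "A \<subseteq> F"
      hence "convex hull A \<subseteq> F"
        using F by (intro hull_minimal) (auto simp: pfaces_def face_of_imp_convex)
      thus False using F face_of_imp_subset by (auto simp: pfaces_def)
    qed
    thus "convex hull (A - F) \<noteq> {}" by auto
  qed
  moreover have "pfaces (convex hull A) \<noteq> {}"
    using two_vertices_in_pfaces[OF assms] by blast
  ultimately show ?thesis
    unfolding PWidth_def using finite_pfaces[OF assms(1)] by (subst Min_gr_iff) auto
qed

lemma PFWidth_pos:
  fixes A :: "'a::euclidean_space set"
  assumes "finite A" "\<exists>a\<in>convex hull A. \<exists>b\<in>convex hull A. a \<noteq> b"
  shows "PFWidth (convex hull A) > 0"
proof -
  let ?P = "pfaces (convex hull A)"
  let ?D = "{setdist F G | F G. F \<in> ?P \<and> G \<in> ?P \<and> F \<inter> G = {}}"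
  have "?D \<subseteq> (\<lambda>(F, G). setdist F G) ` (?P \<times> ?P)" by auto
  hence fin: "finite ?D"
    using finite_pfaces[OF assms(1)] finite_subset by blast
  obtain u v where "u \<noteq> v" "{u} \<in> ?P" "{v} \<in> ?P"
    using two_vertices_in_pfaces[OF assms] .
  hence "setdist {u} {v} \<in> ?D" by blast
  hence "?D \<noteq> {}" by blast
  moreover have "setdist F G > 0" if "F \<in> ?P" "G \<in> ?P" "F \<inter> G = {}" for F G
    using that by (intro setdist_pos_disjoint_compact pfaces_compact[OF assms(1)])
      (auto simp: pfaces_def)
  ultimately show ?thesis
    unfolding PFWidth_def using fin by (subst Min_gr_iff) auto
qed

lemma fw_tau_pos:
  fixes A :: "'a::euclidean_space set"
  assumes "finite A" "\<exists>a\<in>convex hull A. \<exists>b\<in>convex hull A. a \<noteq> b"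
  shows "fw_tau M A > 0"
proof -
  obtain a b where ab: "a \<in> convex hull A" "b \<in> convex hull A" "a \<noteq> b"
    using assms(2) by blast
  have "bounded (convex hull A)"
    using assms(1) by (simp add: finite_imp_bounded_convex_hull)
  hence "dist a b \<le> diameter (convex hull A)" using ab by (intro diameter_bounded_bound)
  moreover have "0 < dist a b" using ab by simp
  ultimately have "0 < diameter (convex hull A)" by linarith
  thus ?thesis using PWidth_pos[OF assms] PFWidth_pos[OF assms] by (cases M) simp_all
qed


section \<open>Quadratic upper model and the short step ball\<close>

text \<open>Along the segment, the derivative of \<open>f\<close> minus its quadratic model is
  \<open>(gradf(x + t(y-x)) - gradf x) \<bullet> (y-x) - L t \<parallel>y-x\<parallel>\<^sup>2\<close>, which is nonpositive by the
  Lipschitz bound.\<close>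

lemma lipschitz_gradient_upper_bound:
  fixes f :: "'a::euclidean_space \<Rightarrow> real"
  assumes "convex S"
    and grad: "\<And>z. z \<in> S \<Longrightarrow> GDERIV f z :> gradf z"
    and lip: "\<And>u v. u \<in> S \<Longrightarrow> v \<in> S \<Longrightarrow> norm (gradf u - gradf v) \<le> L * norm (u - v)"
    and "x \<in> S" "y \<in> S"
  shows "f y \<le> f x + gradf x \<bullet> (y - x) + L / 2 * (norm (y - x))\<^sup>2"
proof -
  define p where "p t = x + t *\<^sub>R (y - x)" for t :: real
  define \<phi> where "\<phi> t = f (p t) - t * (gradf x \<bullet> (y - x)) - L / 2 * t\<^sup>2 * (norm (y - x))\<^sup>2" for t
  have p_in: "p t \<in> S" if "0 \<le> t" "t \<le> 1" for t
  proof -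
    have "p t = (1 - t) *\<^sub>R x + t *\<^sub>R y" by (simp add: p_def algebra_simps)
    thus ?thesis using convexD[OF assms(1) assms(4,5), of "1 - t" t] that by simp
  qed
  have "\<exists>D. DERIV \<phi> t :> D \<and> D \<le> 0" if t: "0 \<le> t" "t \<le> 1" for t
  proof -
    have "(f has_derivative (\<lambda>h. h \<bullet> gradf (p t))) (at (p t))"
      using grad[OF p_in[OF t]] by (simp add: gderiv_def inner_commute)
    moreover have "(p has_derivative (\<lambda>h. h *\<^sub>R (y - x))) (at t)"
      unfolding p_def by (auto intro!: derivative_eq_intros)
    ultimately have "((\<lambda>t. f (p t)) has_derivative (\<lambda>h. (h *\<^sub>R (y - x)) \<bullet> gradf (p t))) (at t)"
      using has_derivative_compose by blast
    hence "DERIV (\<lambda>t. f (p t)) t :> (y - x) \<bullet> gradf (p t)"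
      unfolding has_field_derivative_def
      by (rule has_derivative_eq_rhs) (auto simp: mult.commute)
    hence 1: "DERIV \<phi> t :> (y - x) \<bullet> gradf (p t) - gradf x \<bullet> (y - x) - L * t * (norm (y - x))\<^sup>2"
      unfolding \<phi>_def by (auto intro!: derivative_eq_intros)
    have "(y - x) \<bullet> gradf (p t) - gradf x \<bullet> (y - x) = (gradf (p t) - gradf x) \<bullet> (y - x)"
      by (metis inner_commute inner_diff_left)
    also have "\<dots> \<le> norm (gradf (p t) - gradf x) * norm (y - x)" by (rule norm_cauchy_schwarz)
    also have "\<dots> \<le> (L * norm (p t - x)) * norm (y - x)"
      using lip[OF p_in[OF t] assms(4)] by (intro mult_right_mono) auto
    also have "\<dots> = L * t * (norm (y - x))\<^sup>2" using t by (simp add: p_def power2_eq_square)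
    finally show ?thesis using 1 by force
  qed
  hence "\<phi> 1 \<le> \<phi> 0" by (intro DERIV_nonpos_imp_nonincreasing[of 0 1 \<phi>]) auto
  thus ?thesis by (simp add: \<phi>_def p_def)
qed

text \<open>The ball has the segment from \<open>x\<close> to \<open>x + g/L\<close> as a diameter. By Thales it consists of the
  points \<open>y\<close> with \<open>(y - x) \<bullet> (x + g/L - y) \<ge> 0\<close>.\<close>

lemma short_step_ball_iff:
  fixes x y g :: "'a::euclidean_space"
  assumes "L > 0"
  shows "y \<in> cball (x + (1 / (2 * L)) *\<^sub>R g) (norm g / (2 * L))
           \<longleftrightarrow> L * (norm (y - x))\<^sup>2 \<le> g \<bullet> (y - x)"
proof -
  define v where "v = y - x"
  have "dist (x + (1 / (2 * L)) *\<^sub>R g) y = norm (v - (1 / (2 * L)) *\<^sub>R g)"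
    by (simp add: v_def dist_norm norm_minus_commute algebra_simps)
  hence "y \<in> cball (x + (1 / (2 * L)) *\<^sub>R g) (norm g / (2 * L))
      \<longleftrightarrow> (norm (v - (1 / (2 * L)) *\<^sub>R g))\<^sup>2 \<le> (norm g / (2 * L))\<^sup>2"
    using assms by (simp add: power_mono_iff)
  also have "(norm (v - (1 / (2 * L)) *\<^sub>R g))\<^sup>2
      = (norm v)\<^sup>2 - 2 * (v \<bullet> ((1 / (2 * L)) *\<^sub>R g)) + (norm ((1 / (2 * L)) *\<^sub>R g))\<^sup>2"
    unfolding power2_norm_eq_inner by (simp add: inner_diff_left inner_diff_right inner_commute)
  also have "\<dots> = (norm v)\<^sup>2 - (g \<bullet> v) / L + (norm g / (2 * L))\<^sup>2"
    using assms by (simp add: inner_commute)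
  also have "\<dots> \<le> (norm g / (2 * L))\<^sup>2 \<longleftrightarrow> L * (norm v)\<^sup>2 \<le> g \<bullet> v"
    using assms by (simp add: field_simps)
  finally show ?thesis by (simp add: v_def)
qed

lemma sufficient_decrease_in_short_step_ball:
  fixes f :: "'a::euclidean_space \<Rightarrow> real"
  assumes "convex S" "L > 0"
    and "\<And>z. z \<in> S \<Longrightarrow> GDERIV f z :> gradf z"
    and "\<And>u v. u \<in> S \<Longrightarrow> v \<in> S \<Longrightarrow> norm (gradf u - gradf v) \<le> L * norm (u - v)"
    and "x \<in> S" "y \<in> S"
    and "y \<in> cball (x + (1 / (2 * L)) *\<^sub>R (- gradf x)) (norm (- gradf x) / (2 * L))"
  shows "L / 2 * (norm (y - x))\<^sup>2 \<le> f x - f y"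
proof -
  have "f y \<le> f x + gradf x \<bullet> (y - x) + L / 2 * (norm (y - x))\<^sup>2"
    by (rule lipschitz_gradient_upper_bound[OF assms(1,3,4,5,6)])
  moreover have "L * (norm (y - x))\<^sup>2 \<le> (- gradf x) \<bullet> (y - x)"
    using assms(7) short_step_ball_iff[OF assms(2)] by blast
  ultimately show ?thesis by simp
qed


section \<open>Stepsizes as maxima\<close>

text \<open>The stepsizes are defined with \<open>GREATEST\<close>, which denotes a maximum only when one exists:
  boundedness of \<open>S\<close> and \<open>d \<noteq> 0\<close> make the set of stepsizes compact.\<close>

lemma greatest_stepsize:
  fixes S :: "'a::euclidean_space set"
  assumes "compact S" "y \<in> S" "d \<noteq> 0"
  defines "G \<equiv> GREATEST b. 0 \<le> b \<and> y + b *\<^sub>R d \<in> S"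
  shows "0 \<le> G" "y + G *\<^sub>R d \<in> S"
proof -
  let ?B = "{b. 0 \<le> b \<and> y + b *\<^sub>R d \<in> S}"
  obtain r where r: "\<And>z. z \<in> S \<Longrightarrow> norm z \<le> r"
    using compact_imp_bounded[OF assms(1)] bounded_iff by blast
  have "b \<in> {0 .. (r + norm y) / norm d}" if "b \<in> ?B" for b
  proof -
    have "b * norm d = norm ((y + b *\<^sub>R d) - y)" using that by simp
    also have "\<dots> \<le> norm (y + b *\<^sub>R d) + norm y" by (rule norm_triangle_ineq4)
    also have "\<dots> \<le> r + norm y" using r that by simp
    finally show ?thesis using that assms(3) by (simp add: field_simps)
  qed
  hence "bounded ?B" using bounded_subset[OF bounded_closed_interval] by blast
  moreover have "closed ?B"
  proof -
    have "?B = {0..} \<inter> (\<lambda>b. y + b *\<^sub>R d) -` S" by auto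
    moreover have "closed ((\<lambda>b. y + b *\<^sub>R d) -` S)"
      by (intro closed_vimage compact_imp_closed assms(1) continuous_intros)
    ultimately show ?thesis by auto
  qed
  moreover have "0 \<in> ?B" using assms(2) by simp
  ultimately obtain m where "m \<in> ?B" "\<forall>b\<in>?B. b \<le> m"
    using compact_attains_sup[of ?B] compact_eq_bounded_closed by blast
  hence "G = m" unfolding G_def by (intro Greatest_equality) auto
  thus "0 \<le> G" "y + G *\<^sub>R d \<in> S" using \<open>m \<in> ?B\<close> by auto
qed

lemma convex_shorter_step:
  assumes "convex S" "y \<in> S" "y + b *\<^sub>R d \<in> S" "0 \<le> a" "a \<le> b"
  shows "y + a *\<^sub>R d \<in> S"
proof (cases "b = 0")
  case False
  hence "y + a *\<^sub>R d = (1 - a / b) *\<^sub>R y + (a / b) *\<^sub>R (y + b *\<^sub>R d)"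
    by (simp add: algebra_simps)
  thus ?thesis
    using convexD[OF assms(1,2,3), of "1 - a / b" "a / b"] assms(4,5) False by simp
qed (use assms in auto)

lemma ssc_beta_nonneg:
  assumes "d \<noteq> 0"
  shows "0 \<le> ssc_beta L xb g y d"
  using greatest_stepsize(1)[of "ssc_region L xb g d" y d] assms
  by (auto simp: ssc_beta_def ssc_region_def compact_Int)

lemma ssc_step_stays_in_short_step_ball:
  assumes "d \<noteq> 0" "0 \<le> a" "a \<le> ssc_beta L xb g y d"
    and "y \<in> cball (xb + (1 / (2 * L)) *\<^sub>R g) (norm g / (2 * L))"
  shows "y + a *\<^sub>R d \<in> cball (xb + (1 / (2 * L)) *\<^sub>R g) (norm g / (2 * L))"
proof (cases "y \<in> ssc_region L xb g d")
  case True
  hence "y + ssc_beta L xb g y d *\<^sub>R d \<in> ssc_region L xb g d"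
    using greatest_stepsize(2)[of "ssc_region L xb g d" y d] assms(1)
    by (simp add: ssc_beta_def ssc_region_def compact_Int)
  moreover have "convex (ssc_region L xb g d)"
    by (simp add: ssc_region_def convex_Int)
  ultimately have "y + a *\<^sub>R d \<in> ssc_region L xb g d"
    using convex_shorter_step True assms(2,3) by blast
  thus ?thesis by (simp add: ssc_region_def)
next
  case False
  hence "a = 0" using assms(2,3) by (simp add: ssc_beta_def)
  thus ?thesis using assms(4) by simp
qed


section \<open>Feasibility of the Frank-Wolfe steps\<close>

text \<open>Summing over \<open>A\<close> instead of the support makes the weight updates linear computations.\<close>

lemma active_rep_iff:
  assumes "finite A"
  shows "active_rep A y w \<longleftrightarrow>
    (\<forall>a. 0 \<le> w a) \<and> (\<forall>a. a \<notin> A \<longrightarrow> w a = 0) \<and> (\<Sum>a\<in>A. w a) = 1 \<and> y = (\<Sum>a\<in>A. w a *\<^sub>R a)"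
proof (cases "active_set w \<subseteq> A")
  case True
  have "(\<Sum>a\<in>active_set w. w a) = (\<Sum>a\<in>A. w a)"
    "(\<Sum>a\<in>active_set w. w a *\<^sub>R a) = (\<Sum>a\<in>A. w a *\<^sub>R a)"
    using True assms by (auto intro!: sum.mono_neutral_left simp: active_set_def)
  thus ?thesis using True unfolding active_rep_def active_set_def
    by (auto simp: order.order_iff_strict)
qed (auto simp: active_rep_def active_set_def)

definition fw_state :: "fw_method \<Rightarrow> 'a::euclidean_space set \<Rightarrow> 'a \<Rightarrow> ('a \<Rightarrow> real) \<Rightarrow> bool" where
  "fw_state M A y w \<longleftrightarrow> y \<in> convex hull A \<and> (M \<in> {AFW, PFW} \<longrightarrow> active_rep A y w)"

lemma active_rep_in_hull:
  assumes "finite A" "active_rep A y w"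
  shows "y \<in> convex hull A"
proof -
  have "(\<Sum>a\<in>A. w a *\<^sub>R a) \<in> convex hull A"
    using assms by (intro convex_sum convex_convex_hull) (auto simp: active_rep_iff hull_inc)
  thus ?thesis using assms by (simp add: active_rep_iff)
qed

text \<open>If no point of a convex set improves on \<open>y\<close> in direction \<open>g\<close>, then \<open>g\<close> has nonpositive inner
  product with the whole tangent cone, so the origin is the nearest point of the cone to \<open>g\<close>.\<close>

lemma nonstationary_has_ascent:
  fixes S :: "'a::euclidean_space set"
  assumes "convex S" "y \<in> S" "proj_tangent S y g \<noteq> 0"
  shows "\<exists>z\<in>S. g \<bullet> y < g \<bullet> z"
proof (rule ccontr)
  assume "\<not> (\<exists>z\<in>S. g \<bullet> y < g \<bullet> z)"
  hence le: "g \<bullet> z \<le> g \<bullet> y" if "z \<in> S" for z using that by force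
  let ?C = "{w. \<exists>t>0. y + t *\<^sub>R w \<in> S}"
  have "?C \<subseteq> {w. g \<bullet> w \<le> 0}"
  proof safe
    fix w t assume "(t::real) > 0" "y + t *\<^sub>R w \<in> S"
    thus "g \<bullet> w \<le> 0" using le[of "y + t *\<^sub>R w"] by (simp add: inner_add_right mult_le_0_iff)
  qed
  hence cone: "tangent_cone S y \<subseteq> {w. g \<bullet> w \<le> 0}"
    unfolding tangent_cone_def by (intro closure_minimal closed_halfspace_le)
  have zero: "0 \<in> tangent_cone S y"
    unfolding tangent_cone_def using assms(2)
    by (intro subsetD[OF closure_subset]) (auto intro: exI[of _ 1])
  define c where "c = closest_point (tangent_cone S y) g"
  have cl: "closed (tangent_cone S y)" by (simp add: tangent_cone_def)
  have "c \<in> tangent_cone S y" unfolding c_def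
    using closest_point_in_set[OF cl] zero by blast
  hence "g \<bullet> c \<le> 0" using cone by blast
  moreover have "dist g c \<le> dist g 0" unfolding c_def
    using closest_point_le[OF cl zero] .
  hence "(norm (g - c))\<^sup>2 \<le> (norm g)\<^sup>2" by (simp add: dist_norm)
  hence "(norm c)\<^sup>2 \<le> 2 * (g \<bullet> c)"
    by (simp add: power2_norm_eq_inner inner_diff_left inner_diff_right inner_commute)
  ultimately have "(norm c)\<^sup>2 \<le> 0" by linarith
  hence "c = 0" by simp
  thus False using assms(3) by (simp add: proj_tangent_def c_def)
qed

text \<open>Each selected direction makes at least the progress of the forward direction \<open>s - y\<close>. For
  AFW and FDFW this is the choice rule. For PFW it holds because \<open>q\<close> minimizes \<open>g\<close> over the
  active atoms, of which \<open>y\<close> is a convex combination.\<close>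

lemma fw_direction_ascent:
  fixes A :: "'a::euclidean_space set"
  assumes "fw_direction A g M y w d \<alpha>max upd" "finite A" "fw_state M A y w"
    and "proj_tangent (convex hull A) y g \<noteq> 0"
  shows "g \<bullet> d > 0"
proof -
  obtain z where z: "z \<in> convex hull A" "g \<bullet> y < g \<bullet> z"
    using nonstationary_has_ascent[OF convex_convex_hull _ assms(4)] assms(3)
    by (auto simp: fw_state_def)
  have fwd: "g \<bullet> (s - y) > 0" if "is_arg_max (\<lambda>z. z \<bullet> g) (\<lambda>z. z \<in> convex hull A) s" for s
    using that z by (force simp: is_arg_max_linorder inner_diff_right inner_commute)
  show ?thesis using assms(1)
  proof cases
    case (AFW_forward s q)
    thus ?thesis using fwd by simp
  next
    case (AFW_away s q)
    have "g \<bullet> (s - y) \<le> g \<bullet> (y - q)" using AFW_away by (simp add: is_arg_max_linorder)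
    thus ?thesis using fwd[of s] AFW_away by simp
  next
    case (PFW_pairwise s q)
    have w: "\<And>a. 0 \<le> w a" "(\<Sum>a\<in>A. w a) = 1" "y = (\<Sum>a\<in>A. w a *\<^sub>R a)"
      using assms(2,3) PFW_pairwise by (auto simp: fw_state_def active_rep_iff)
    have "w a * (q \<bullet> g) \<le> w a * (a \<bullet> g)" for a
      using w(1)[of a] PFW_pairwise
      by (cases "w a = 0") (auto simp: is_arg_min_linorder active_set_def intro: mult_left_mono)
    hence "(\<Sum>a\<in>A. w a * (q \<bullet> g)) \<le> (\<Sum>a\<in>A. w a * (a \<bullet> g))" by (intro sum_mono)
    hence "q \<bullet> g \<le> y \<bullet> g"
      using w by (simp add: inner_sum_left flip: sum_distrib_right)
    thus ?thesis using fwd[of s] PFW_pairwise by (simp add: inner_diff_right inner_commute)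
  next
    case (FDFW_step s yF)
    have "g \<bullet> (s - y) \<le> g \<bullet> d" using FDFW_step by (simp add: is_arg_max_linorder)
    thus ?thesis using fwd[of s] FDFW_step by simp
  qed
qed

text \<open>One computation covers the weight updates of AFW and PFW: weight \<open>a\<close> is added to the atom
  \<open>s\<close> and weight \<open>b\<close> is taken from the atom \<open>q\<close>, after a scaling by \<open>c\<close> that restores the sum 1.\<close>

lemma active_rep_update:
  fixes A :: "'a::euclidean_space set"
  assumes "finite A" "active_rep A y w" "s \<in> A" "q \<in> A" "c + a - b = 1"
  defines "v \<equiv> \<lambda>p. c * w p + (if p = s then a else 0) - (if p = q then b else 0)"
  assumes "\<And>p. 0 \<le> v p"
  shows "active_rep A (c *\<^sub>R y + a *\<^sub>R s - b *\<^sub>R q) v"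
proof -
  have w: "\<And>p. p \<notin> A \<Longrightarrow> w p = 0" "(\<Sum>p\<in>A. w p) = 1" "y = (\<Sum>p\<in>A. w p *\<^sub>R p)"
    using assms(1,2) by (simp_all add: active_rep_iff)
  have pt: "(\<Sum>p\<in>A. (if p = r then t else 0) *\<^sub>R p) = t *\<^sub>R r" if "r \<in> A" for r t
  proof -
    have "(\<Sum>p\<in>A. (if p = r then t else 0) *\<^sub>R p) = (\<Sum>p\<in>A. if p = r then t *\<^sub>R r else 0)"
      by (rule sum.cong) auto
    thus ?thesis using that assms(1) by simp
  qed
  have "(\<Sum>p\<in>A. v p) = c * (\<Sum>p\<in>A. w p) + a - b"
    unfolding v_def using assms(1,3,4)
    by (simp add: sum.distrib sum_subtractf sum_distrib_left)
  moreover have "(\<Sum>p\<in>A. v p *\<^sub>R p) = c *\<^sub>R (\<Sum>p\<in>A. w p *\<^sub>R p) + a *\<^sub>R s - b *\<^sub>R q"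
    unfolding v_def scaleR_diff_left scaleR_add_left sum_subtractf sum.distrib pt[OF assms(3)] pt[OF assms(4)]
    by (simp add: scaleR_sum_right)
  moreover have "v p = 0" if "p \<notin> A" for p
    using that assms(3,4) w(1) by (auto simp: v_def)
  ultimately show ?thesis
    using assms(5,7) w(2,3) by (simp add: active_rep_iff[OF assms(1)])
qed

text \<open>The maximal stepsizes are those at which a weight reaches zero or the point reaches the
  relative boundary.\<close>

lemma fw_step_keeps_state:
  fixes A :: "'a::euclidean_space set"
  assumes "fw_direction A g M y w d \<alpha>max upd" "finite A" "fw_state M A y w" "d \<noteq> 0"
  shows "0 \<le> \<alpha>max" and "0 \<le> \<alpha> \<Longrightarrow> \<alpha> \<le> \<alpha>max \<Longrightarrow> fw_state M A (y + \<alpha> *\<^sub>R d) (upd \<alpha>)"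
proof -
  have "0 \<le> \<alpha>max \<and> (0 \<le> \<alpha> \<longrightarrow> \<alpha> \<le> \<alpha>max \<longrightarrow> fw_state M A (y + \<alpha> *\<^sub>R d) (upd \<alpha>))"
  proof (cases "M = FDFW")
    case True
    have y: "y \<in> convex hull A" using assms(3) by (simp add: fw_state_def)
    have G: "\<alpha>max = (GREATEST a. 0 \<le> a \<and> y + a *\<^sub>R d \<in> convex hull A)"
      using assms(1) True by (auto elim: fw_direction.cases)
    have comp: "compact (convex hull A)" using assms(2) by (rule finite_imp_compact_convex_hull)
    have "0 \<le> \<alpha>max" "y + \<alpha>max *\<^sub>R d \<in> convex hull A"
      using greatest_stepsize[OF comp y assms(4)] unfolding G .
    thus ?thesis
      using convex_shorter_step[OF convex_convex_hull y] True by (simp add: fw_state_def)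
  next
    case False
    hence rep: "active_rep A y w" using assms(3) by (cases M) (auto simp: fw_state_def)
    hence w: "\<And>a. 0 \<le> w a" "\<And>a. a \<notin> A \<Longrightarrow> w a = 0" "(\<Sum>a\<in>A. w a) = 1"
      using assms(2) by (simp_all add: active_rep_iff)
    have le1: "w a \<le> 1" for a
      using member_le_sum[of a A w] w assms(2) by (cases "a \<in> A") simp_all
    have minimizer_in: "q \<in> A" if "is_arg_min h (\<lambda>z. z \<in> active_set w) q" for h :: "'a \<Rightarrow> real" and q
      using that w(2) by (auto simp: is_arg_min_def active_set_def)
    note update = active_rep_update[OF assms(2) rep]
    have "0 \<le> \<alpha>max \<and> (0 \<le> \<alpha> \<longrightarrow> \<alpha> \<le> \<alpha>max \<longrightarrow> active_rep A (y + \<alpha> *\<^sub>R d) (upd \<alpha>))"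
      using assms(1)
    proof cases
      case (AFW_forward s q)
      have "active_rep A (y + \<alpha> *\<^sub>R (s - y)) (\<lambda>a. (1 - \<alpha>) * w a + (if a = s then \<alpha> else 0))"
        if "0 \<le> \<alpha>" "\<alpha> \<le> 1"
      proof -
        have "y + \<alpha> *\<^sub>R (s - y) = (1 - \<alpha>) *\<^sub>R y + \<alpha> *\<^sub>R s" by (simp add: algebra_simps)
        thus ?thesis using update[of s s "1 - \<alpha>" \<alpha> 0] AFW_forward(5) w(1) that by simp
      qed
      thus ?thesis unfolding AFW_forward(2-4) by simp
    next
      case (AFW_away s q)
      have q: "q \<in> A" using minimizer_in AFW_away(7) .
      have "active_rep A (y + \<alpha> *\<^sub>R (y - q)) (\<lambda>a. (1 + \<alpha>) * w a - (if a = q then \<alpha> else 0))"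
        if \<alpha>: "0 \<le> \<alpha>" "\<alpha> \<le> w q / (1 - w q)"
      proof -
        (* If w q = 1, the division by zero makes the maximal stepsize 0. *)
        have "\<alpha> * (1 - w q) \<le> w q"
          using \<alpha> le1[of q] by (cases "w q = 1") (simp_all add: pos_le_divide_eq)
        hence "\<alpha> \<le> (1 + \<alpha>) * w q" by (simp add: algebra_simps)
        thus ?thesis
          using update[of q q "1 + \<alpha>" 0 \<alpha>] q w(1) \<alpha>(1) by (simp add: algebra_simps)
      qed
      moreover have "0 \<le> w q / (1 - w q)" using w(1) le1 by simp
      ultimately show ?thesis unfolding AFW_away(2-4) by simp
    next
      case (PFW_pairwise s q)
      have q: "q \<in> A" using minimizer_in PFW_pairwise(7) .
      have "active_rep A (y + \<alpha> *\<^sub>R (s - q))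
          (\<lambda>a. w a + (if a = s then \<alpha> else 0) - (if a = q then \<alpha> else 0))"
        if "0 \<le> \<alpha>" "\<alpha> \<le> w q"
        using update[of s q 1 \<alpha> \<alpha>] PFW_pairwise(5) q w(1) that by (simp add: algebra_simps)
      thus ?thesis unfolding PFW_pairwise(2-4) using w(1) by simp
    next
      case FDFW_step
      thus ?thesis using False by simp
    qed
    thus ?thesis using active_rep_in_hull[OF assms(2)] unfolding fw_state_def by blast
  qed
  thus "0 \<le> \<alpha>max" "0 \<le> \<alpha> \<Longrightarrow> \<alpha> \<le> \<alpha>max \<Longrightarrow> fw_state M A (y + \<alpha> *\<^sub>R d) (upd \<alpha>)" by blast+
qed


section \<open>Invariants of the short step chain\<close>

lemma ssc_step_invariant:
  assumes "finite A" "fw_state M A y w"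
    and "y \<in> cball (xb + (1 / (2 * L)) *\<^sub>R g) (norm g / (2 * L))"
    and "proj_tangent (convex hull A) y g \<noteq> 0" "fw_direction A g M y w d \<alpha>max upd"
    and "\<alpha> = min \<alpha>max (ssc_beta L xb g y d)"
  shows "fw_state M A (y + \<alpha> *\<^sub>R d) (upd \<alpha>)"
    and "y + \<alpha> *\<^sub>R d \<in> cball (xb + (1 / (2 * L)) *\<^sub>R g) (norm g / (2 * L))"
proof -
  have "d \<noteq> 0" using fw_direction_ascent[OF assms(5,1,2,4)] by auto
  have \<alpha>: "0 \<le> \<alpha>" "\<alpha> \<le> \<alpha>max" "\<alpha> \<le> ssc_beta L xb g y d"
    using fw_step_keeps_state(1)[OF assms(5,1,2) \<open>d \<noteq> 0\<close>] ssc_beta_nonneg[OF \<open>d \<noteq> 0\<close>] assms(6)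
    by auto
  show "fw_state M A (y + \<alpha> *\<^sub>R d) (upd \<alpha>)"
    using fw_step_keeps_state(2)[OF assms(5,1,2) \<open>d \<noteq> 0\<close>] \<alpha> by blast
  show "y + \<alpha> *\<^sub>R d \<in> cball (xb + (1 / (2 * L)) *\<^sub>R g) (norm g / (2 * L))"
    using ssc_step_stays_in_short_step_ball[OF \<open>d \<noteq> 0\<close>] \<alpha> assms(3) by blast
qed

lemma ssc_trace_invariant:
  assumes "ssc_trace M A L xb g yw ys" "finite A"
    and "fw_state M A (fst yw) (snd yw)"
    and "fst yw \<in> cball (xb + (1 / (2 * L)) *\<^sub>R g) (norm g / (2 * L))"
  shows "ys \<noteq> [] \<and> fw_state M A (fst (last ys)) (snd (last ys)) \<and>
         fst (last ys) \<in> cball (xb + (1 / (2 * L)) *\<^sub>R g) (norm g / (2 * L))"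
  using assms
proof (induction rule: ssc_trace.induct)
  case (stationary y w)
  thus ?case by simp
next
  case (return y w d \<alpha>max upd \<alpha>)
  thus ?case using ssc_step_invariant[of A M y w xb L g d \<alpha>max upd \<alpha>] by simp
next
  case (continue y w d \<alpha>max upd \<alpha> ys)
  thus ?case using ssc_step_invariant[of A M y w xb L g d \<alpha>max upd \<alpha>] by simp
qed

lemma fom_ssc_step:
  assumes "fom_ssc M A L gradf x w tr" "finite A" "L > 0" "fw_state M A (x k) (w k)"
  shows "fw_state M A (x (Suc k)) (w (Suc k))"
    and "x (Suc k) \<in> cball (x k + (1 / (2 * L)) *\<^sub>R (- gradf (x k))) (norm (- gradf (x k)) / (2 * L))"
proof -
  let ?g = "- gradf (x k)"
  have start: "x k \<in> cball (x k + (1 / (2 * L)) *\<^sub>R ?g) (norm ?g / (2 * L))"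
    by (subst short_step_ball_iff[OF assms(3)]) simp
  have last: "(x (Suc k), w (Suc k)) = last (tr k)"
    and tr: "if proj_tangent (convex hull A) (x k) ?g = 0 then tr k = [(x k, w k)]
             else ssc_trace M A L (x k) ?g (x k, w k) (tr k)"
    using assms(1) unfolding fom_ssc_def by blast+
  have "fw_state M A (fst (last (tr k))) (snd (last (tr k))) \<and>
      fst (last (tr k)) \<in> cball (x k + (1 / (2 * L)) *\<^sub>R ?g) (norm ?g / (2 * L))"
  proof (cases "proj_tangent (convex hull A) (x k) ?g = 0")
    case True
    thus ?thesis using tr assms(4) start by simp
  next
    case False
    hence "ssc_trace M A L (x k) ?g (x k, w k) (tr k)" using tr by simp
    from ssc_trace_invariant[OF this assms(2)] show ?thesis using assms(4) start by simp
  qed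
  thus "fw_state M A (x (Suc k)) (w (Suc k))"
    "x (Suc k) \<in> cball (x k + (1 / (2 * L)) *\<^sub>R ?g) (norm ?g / (2 * L))"
    by (simp_all flip: last)
qed

lemma fom_ssc_state:
  assumes "fom_ssc M A L gradf x w tr" "finite A" "L > 0"
  shows "fw_state M A (x k) (w k)"
proof (induction k)
  case 0
  thus ?case using assms(1) by (simp add: fom_ssc_def fw_state_def)
next
  case (Suc k)
  thus ?case by (rule fom_ssc_step(1)[OF assms])
qed


section \<open>Rate from sufficient decrease\<close>

lemma convergent_of_sufficient_decrease:
  fixes F r :: "nat \<Rightarrow> real"
  assumes "c > 0" "\<And>k. c * (r k)\<^sup>2 \<le> F k - F (Suc k)" "\<And>k. m \<le> F k"
  shows "convergent F" and "lim F \<le> F k"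
proof -
  have dec: "decseq F"
  proof (rule decseq_SucI)
    fix k
    have "0 \<le> c * (r k)\<^sup>2" using assms(1) by simp
    thus "F (Suc k) \<le> F k" using assms(2)[of k] by linarith
  qed
  then obtain l where "F \<longlonglongrightarrow> l" using decseq_convergent[OF dec] assms(3) by blast
  thus "convergent F" "lim F \<le> F k"
    using decseq_ge[OF dec] by (auto simp: convergent_def limI)
qed

lemma min_step_rate:
  fixes F r :: "nat \<Rightarrow> real"
  assumes "c > 0" "\<And>k. c * (r k)\<^sup>2 \<le> F k - F (Suc k)" "\<And>k. m \<le> F k" "\<And>k. 0 \<le> r k"
  shows "(MIN i\<in>{0..k}. r i) \<le> sqrt ((F 0 - lim F) / (c * (real k + 1)))"
proof (rule real_le_rsqrt)
  let ?m = "MIN i\<in>{0..k}. r i"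
  have "?m \<in> r ` {0..k}" by (intro Min_in) auto
  hence "0 \<le> ?m" using assms(4) by auto
  hence "?m\<^sup>2 \<le> (r i)\<^sup>2" if "i < Suc k" for i
    using that by (intro power_mono Min_le) auto
  hence "(\<Sum>i<Suc k. c * ?m\<^sup>2) \<le> (\<Sum>i<Suc k. c * (r i)\<^sup>2)"
    using assms(1) by (intro sum_mono mult_left_mono) auto
  also have "\<dots> \<le> (\<Sum>i<Suc k. F i - F (Suc i))" using assms(2) by (intro sum_mono)
  also have "\<dots> = F 0 - F (Suc k)" by (rule sum_lessThan_telescope')
  also have "\<dots> \<le> F 0 - lim F" using convergent_of_sufficient_decrease(2)[where F = F and r = r, OF assms(1-3)] by simp
  finally have "?m\<^sup>2 * (c * (real k + 1)) \<le> F 0 - lim F" by (simp add: algebra_simps)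
  thus "?m\<^sup>2 \<le> (F 0 - lim F) / (c * (real k + 1))"
    using assms(1) by (simp add: pos_le_divide_eq)
qed


section \<open>The rate for the projected gradient\<close>

theorem corollary4p1:
  fixes A \<Omega> U :: "(real ^ 'n) set"
    and f :: "real ^ 'n \<Rightarrow> real" and gradf :: "real ^ 'n \<Rightarrow> real ^ 'n"
    and L \<tau> K :: real and M :: fw_method
    and x xt :: "nat \<Rightarrow> real ^ 'n" and w :: "nat \<Rightarrow> real ^ 'n \<Rightarrow> real"
    and tr :: "nat \<Rightarrow> ((real ^ 'n) \<times> (real ^ 'n \<Rightarrow> real)) list"
  assumes "finite A" and "\<Omega> = convex hull A" and "\<exists>a\<in>\<Omega>. \<exists>b\<in>\<Omega>. a \<noteq> b"
    and "open U" and "\<Omega> \<subseteq> U" and "\<And>y. y \<in> U \<Longrightarrow> GDERIV f y :> gradf y"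
    and "continuous_on U gradf"
    and "L > 0"
    and "\<And>y z. y \<in> \<Omega> \<Longrightarrow> z \<in> \<Omega> \<Longrightarrow> norm (gradf y - gradf z) \<le> L * norm (y - z)"
    and "fom_ssc M A L gradf x w tr"
    and "\<tau> = fw_tau M A" and "K = \<tau> / (L * (1 + \<tau>))"
    and "\<And>k. xt k \<in> fst ` set (tr k)"
    and "\<And>k. f (x (Suc k)) \<le> f (xt k)"
    and "\<And>k. f (xt k) \<le> f (x k) - L / 2 * (norm (x k - xt k))\<^sup>2"
    and "\<And>k. norm (xt k - x k) \<le> norm (x (Suc k) - x k)"
    and "\<And>k. norm (x k - x (Suc k)) \<ge> K * proj_tangent \<Omega> (xt k) (- gradf (xt k))"
  shows "convergent (\<lambda>k. f (x k)) \<and>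
    (\<forall>k. (MIN i\<in>{0..k}. proj_tangent \<Omega> (xt i) (- gradf (xt i)))
           \<le> (MIN i\<in>{0..k}. norm (x (Suc i) - x i) / K) \<and>
         (MIN i\<in>{0..k}. norm (x (Suc i) - x i) / K)
           \<le> sqrt (2 * (f (x 0) - lim (\<lambda>k. f (x k))) / (K\<^sup>2 * L * (real k + 1))))"
proof -
  note hull = assms(2)
  have "0 < \<tau>" using fw_tau_pos[of A M] assms(1,3,11) unfolding hull by simp
  hence K: "0 < K" using assms(8,12) by simp
  have state: "fw_state M A (x k) (w k)" for k
    by (rule fom_ssc_state[OF assms(10,1,8)])
  hence x_in: "x k \<in> \<Omega>" for k by (simp add: fw_state_def hull)
  have grad: "GDERIV f y :> gradf y" if "y \<in> \<Omega>" for y using that assms(5,6) by blast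
  have conv: "convex \<Omega>" by (simp add: hull)
  have decrease: "L / 2 * (norm (x (Suc k) - x k))\<^sup>2 \<le> f (x k) - f (x (Suc k))" for k
    using sufficient_decrease_in_short_step_ball[OF conv assms(8) grad assms(9) x_in x_in]
      fom_ssc_step(2)[OF assms(10,1,8) state] by blast
  define r where "r i = norm (x (Suc i) - x i) / K" for i
  have r_decrease: "K\<^sup>2 * L / 2 * (r k)\<^sup>2 \<le> f (x k) - f (x (Suc k))" for k
    using decrease[of k] K by (simp add: r_def power_divide)
  have "continuous_on \<Omega> f"
    using grad by (intro continuous_at_imp_continuous_on ballI) (auto simp: gderiv_def intro: has_derivative_continuous)
  moreover have "compact \<Omega>" using assms(1) by (simp add: hull finite_imp_compact_convex_hull)
  moreover have "\<Omega> \<noteq> {}" using x_in by blast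
  ultimately obtain z where lower: "\<And>k. f z \<le> f (x k)"
    using continuous_attains_inf[of \<Omega> f] x_in by blast
  have c: "0 < K\<^sup>2 * L / 2" using K assms(8) by simp
  note rates = c r_decrease lower
  have "(MIN i\<in>{0..k}. proj_tangent \<Omega> (xt i) (- gradf (xt i))) \<le> (MIN i\<in>{0..k}. r i)" for k
  proof -
    have "proj_tangent \<Omega> (xt i) (- gradf (xt i)) \<le> r i" for i
      using assms(17)[of i] K by (simp add: r_def pos_le_divide_eq norm_minus_commute mult.commute)
    moreover have "(MIN i\<in>{0..k}. proj_tangent \<Omega> (xt i) (- gradf (xt i)))
        \<le> proj_tangent \<Omega> (xt i) (- gradf (xt i))" if "i \<in> {0..k}" for i
      using that by (intro Min_le) auto
    ultimately have "(MIN i\<in>{0..k}. proj_tangent \<Omega> (xt i) (- gradf (xt i))) \<le> r i"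
      if "i \<in> {0..k}" for i
      using that order_trans by blast
    thus ?thesis by (subst Min_ge_iff) auto
  qed
  moreover have "(MIN i\<in>{0..k}. r i)
      \<le> sqrt (2 * (f (x 0) - lim (\<lambda>k. f (x k))) / (K\<^sup>2 * L * (real k + 1)))" for k
  proof -
    have "(f (x 0) - l) / (K\<^sup>2 * L / 2 * (real k + 1)) = 2 * (f (x 0) - l) / (K\<^sup>2 * L * (real k + 1))"
      for l by simp
    thus ?thesis
      using min_step_rate[where F = "\<lambda>k. f (x k)" and r = r, OF rates, of k] K
      by (simp add: r_def del: times_divide_eq_left)
  qed
  moreover have "convergent (\<lambda>k. f (x k))"
    by (rule convergent_of_sufficient_decrease(1)[where F = "\<lambda>k. f (x k)" and r = r, OF rates])
  ultimately show ?thesis unfolding r_def by blast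
qed

end
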